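(* Let $G$ be a connected graph of order $n \ge 3$. Then $\gamma_{\rm it}^{\rm g\prime}(G) \le \frac{5}{6}n$.
   Context: All graphs are finite and simple. For a vertex set $S$, $N_G(S)$ denotes the set of vertices adjacent to at least one vertex of $S$, and $G - X$ is the graph obtained by deleting the vertices of $X$. The total isolation game on a graph $G$ is played by two players, Dominator and Staller, who alternately select vertices of $G$. If $S$ is the set of vertices selected so far, a vertex $v$ may be selected only if $v$ is adjacent to some vertex $u$ such that either $u$ belongs to a component of $G - N_G(S)$ of order at least $2$, or $u \in S$ and $u$ is an isolated vertex of $G - N_G(S)$. The game ends when no such vertex exists. Dominator aims to minimize the total number of selected vertices, Staller aims to maximize it. $\gamma_{\rm it}^{\rm g\prime}(G)$ is the number of moves in the game in which Staller makes the first move and both players play optimally. *)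

theory Defs
  imports Complex_Main "Graph_Theory.Digraph_Component"
begin

text \<open>
  As in the Graph_Theory library, a finite simple undirected graph is a finite, symmetric, loop-free
  digraph without multiple arcs (locale \<^locale>\<open>graph\<close>), and adjacency is
  \<open>u \<rightarrow>\<^bsub>G\<^esub> v\<close>.
\<close>

definition component :: "('a, 'b) pre_digraph \<Rightarrow> ('a, 'b) pre_digraph \<Rightarrow> bool" where
  "component H C \<longleftrightarrow> pre_digraph.max_subgraph H Digraph_Component.connected C"

definition isolated_vertex :: "('a, 'b) pre_digraph \<Rightarrow> 'a \<Rightarrow> bool" where
  "isolated_vertex H u \<longleftrightarrow> u \<in> verts H \<and> (\<forall>w \<in> verts H. \<not> u \<rightarrow>\<^bsub>H\<^esub> w)"

context pre_digraph
begin

definition open_nbhd :: "'a set \<Rightarrow> 'a set" where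
  "open_nbhd S = {v \<in> verts G. \<exists>s \<in> S. v \<rightarrow>\<^bsub>G\<^esub> s}"

definition delete_verts :: "'a set \<Rightarrow> ('a, 'b) pre_digraph" where
  "delete_verts X = G \<restriction> (verts G - X)"

definition playable :: "'a set \<Rightarrow> 'a set" where
  "playable S = {v \<in> verts G. \<exists>u \<in> verts G. v \<rightarrow>\<^bsub>G\<^esub> u \<and>
     ((\<exists>C. component (delete_verts (open_nbhd S)) C \<and> u \<in> verts C \<and> card (verts C) \<ge> 2) \<or>
      (u \<in> S \<and> isolated_vertex (delete_verts (open_nbhd S)) u))}"

end

lemma (in graph) playable_disjoint: "playable S \<inter> S = {}"
proof -
  have "v \<notin> S" if "v \<in> playable S" for v
  proof
    assume "v \<in> S"
    from that obtain u where u: "u \<in> verts G" "v \<rightarrow>\<^bsub>G\<^esub> u"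
      and "u \<in> verts (delete_verts (open_nbhd S))"
      unfolding playable_def component_def isolated_vertex_def pre_digraph.max_subgraph_def
        subgraph_def by blast
    then have "u \<notin> open_nbhd S" by (simp add: delete_verts_def)
    moreover have "u \<rightarrow>\<^bsub>G\<^esub> v" using u graph_symmetric by blast
    ultimately show False using \<open>v \<in> S\<close> u by (auto simp: open_nbhd_def)
  qed
  then show ?thesis by blast
qed

lemma (in graph) card_unselected_decreases:
  assumes "v \<in> playable S"
  shows "card (verts G - insert v S) < card (verts G - S)"
proof -
  have "v \<in> verts G - S" using assms playable_disjoint by (auto simp: playable_def)
  then show ?thesis by (intro psubset_card_mono) auto
qed

datatype player = Dominator | Staller

text \<open>
  \<open>optimal_moves p S\<close> is the number of moves still made under optimal play when the vertices
  in \<open>S\<close> have been selected and it is the turn of \<open>p\<close>.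
\<close>

function (in graph) optimal_moves :: "player \<Rightarrow> 'a set \<Rightarrow> nat" where
  "optimal_moves Dominator S =
     (if playable S = {} then 0
      else 1 + Min ((\<lambda>v. optimal_moves Staller (insert v S)) ` playable S))"
| "optimal_moves Staller S =
     (if playable S = {} then 0
      else 1 + Max ((\<lambda>v. optimal_moves Dominator (insert v S)) ` playable S))"
  by pat_completeness auto
termination (in graph)
  by (relation "measure (\<lambda>(p, S). card (verts G - S))") (auto intro: card_unselected_decreases)

definition (in graph) staller_start_game_number :: nat where
  "staller_start_game_number = optimal_moves Staller {}"

end

theory Submission
  imports Defs
begin

text \<open>
  Call an undominated vertex useful if it is selected or has an undominated neighbour; every move
  removes a useful vertex. As long as some useful vertex is unselected or two useful vertices have
  a common neighbour, Dominator can remove two of them at once. Otherwise the \<open>k\<close> remaining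
  useful vertices are selected and have disjoint sets of unselected neighbours, so \<open>k\<close> is at most
  half the order \<open>n\<close>, and at most \<open>k\<close> moves follow. Since a pair of moves costs three useful
  vertices, from \<open>m\<close> useful vertices Dominator to move gets away with
  \<open>2/3 * (m - k) + k \<le> 2/3 * m + n/6\<close> moves.
  Staller's extra first move is paid for by its dominating two vertices or, if it is a leaf, by
  Dominator replying at its neighbour: both then are selected and dominated, which improves the
  bound on \<open>k\<close> to \<open>n/2 - 1\<close>.
\<close>

section \<open>Connectedness and nontrivial components\<close>

lemma connected_crossing_arc:
  assumes "wf_digraph K" "Digraph_Component.connected K"
    and "X \<subseteq> verts K" "X \<noteq> {}" "X \<noteq> verts K"
  obtains x y where "x \<in> X" "y \<in> verts K - X" "x \<rightarrow>\<^bsub>K\<^esub> y \<or> y \<rightarrow>\<^bsub>K\<^esub> x"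
proof -
  interpret K: wf_digraph K by fact
  interpret M: pair_wf_digraph "mk_symmetric K" by (rule K.wellformed_mk_symmetric)
  obtain a b where a: "a \<in> X" and b: "b \<in> verts K" "b \<notin> X" using assms by blast
  have "a \<rightarrow>\<^sup>*\<^bsub>mk_symmetric K\<^esub> b"
    using assms(2,3) a b by (auto simp: connected_def strongly_connected_def)
  \<comment> \<open>Induction along the path in \<open>mk_symmetric K\<close>: it stays in
    \<open>X\<close> until some arc crosses.\<close>
  then have "b \<in> X \<or> (\<exists>x \<in> X. \<exists>y \<in> verts K - X. x \<rightarrow>\<^bsub>K\<^esub> y \<or> y \<rightarrow>\<^bsub>K\<^esub> x)"
  proof (induction rule: M.reachable_induct)
    case base
    show ?case using a by blast
  next
    case (step x y)
    have "x \<rightarrow>\<^bsub>K\<^esub> y \<or> y \<rightarrow>\<^bsub>K\<^esub> x"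
      using step(2) by (auto simp: mk_symmetric_def arcs_ends_conv)
    moreover have "y \<in> verts K" using calculation K.adj_in_verts by blast
    ultimately show ?case using step(3) by blast
  qed
  then show thesis using b that by blast
qed

text \<open>With symmetric arcs, weak and strong connectivity agree. A connected \<open>H\<close>
  above the strong component of \<open>u\<close> reaches all its vertices from \<open>u\<close>, so
  it has no more vertices, and no more arcs since the component is induced.\<close>

lemma (in sym_digraph) component_scc_of:
  assumes u: "u \<in> verts G"
  shows "component G (G \<restriction> scc_of u)"
proof -
  let ?C = "G \<restriction> scc_of u"
  have scc: "?C \<in> sccs"
    using scc_of_in_sccs_verts[OF u] in_sccs_verts_conv by blast
  then have ind: "induced_subgraph ?C G" and sc: "strongly_connected ?C"
    by (auto simp: sccs_def)
  have subC: "subgraph ?C G" using ind by (rule induced_imp_subgraph)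
  have wfC: "wf_digraph ?C" using subC by (auto simp: subgraph_def)
  have conC: "Digraph_Component.connected ?C"
    using sc wfC unfolding connected_def strongly_connected_def
    by (auto intro: wf_digraph.reachable_mk_symmetricI)
  have "H = ?C" if sub: "subgraph ?C H" "subgraph H G" and con: "Digraph_Component.connected H" for H
  proof -
    have uH: "u \<in> verts H"
      using sub(1) in_scc_of_self[OF u] by (auto simp: subgraph_def)
    have vs: "v \<in> scc_of u" if "v \<in> verts H" for v
    proof -
      have "u \<rightarrow>\<^sup>*\<^bsub>mk_symmetric H\<^esub> v"
        using con uH that by (auto simp: connected_def strongly_connected_def)
      moreover have "subgraph (mk_symmetric H) (mk_symmetric G)"
        using sub(2) by (rule subgraph_mk_symmetric)
      ultimately have "u \<rightarrow>\<^sup>*\<^bsub>mk_symmetric G\<^esub> v"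
        by (rule pre_digraph.reachable_mono)
      then have "u \<rightarrow>\<^sup>*\<^bsub>G\<^esub> v" using reachable_mk_symmetric_eq sym_arcs by blast
      then show ?thesis by (rule scc_ofI_reachable')
    qed
    have "verts H = verts ?C" using vs sub(1) by (auto simp: subgraph_def)
    moreover have "arcs H = arcs ?C"
    proof
      show "arcs ?C \<subseteq> arcs H" using sub(1) by (auto simp: subgraph_def)
      show "arcs H \<subseteq> arcs ?C"
      proof
        fix e assume e: "e \<in> arcs H"
        then have "tail H e \<in> verts H" "head H e \<in> verts H"
          using sub by (auto simp: subgraph_def wf_digraph.tail_in_verts wf_digraph.head_in_verts)
        then show "e \<in> arcs ?C" using e vs sub(2)
          by (auto simp: subgraph_def compatible_def)
      qed
    qed
    ultimately show ?thesis using sub(2) by (auto simp: subgraph_def compatible_def)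
  qed
  then show ?thesis
    using subC conC unfolding component_def by (intro max_subgraphI) auto
qed

text \<open>Makes the first clause of the rule of play local: in a component of order at least 2
  some arc leaves \<open>{u}\<close>, and conversely \<open>u\<close> and a neighbour share a strong
  component.\<close>

lemma (in sym_digraph) in_nontrivial_component_iff:
  assumes "fin_digraph G" "loopfree_digraph G"
  shows "(\<exists>C. component G C \<and> u \<in> verts C \<and> card (verts C) \<ge> 2) \<longleftrightarrow> (\<exists>w. u \<rightarrow>\<^bsub>G\<^esub> w)"
proof
  assume "\<exists>C. component G C \<and> u \<in> verts C \<and> card (verts C) \<ge> 2"
  then obtain C where C: "subgraph C G" "Digraph_Component.connected C" "u \<in> verts C"
      "card (verts C) \<ge> 2"
    by (auto simp: component_def max_subgraph_def)
  have "{u} \<noteq> verts C"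
  proof
    assume "{u} = verts C"
    then show False using C(4) by (metis card_1_singleton_iff numeral_le_one_iff semiring_norm(69) One_nat_def)
  qed
  moreover have "wf_digraph C" using C(1) by (auto simp: subgraph_def)
  ultimately obtain y where "u \<rightarrow>\<^bsub>C\<^esub> y \<or> y \<rightarrow>\<^bsub>C\<^esub> u"
    using connected_crossing_arc[of C "{u}"] C by blast
  then have "u \<rightarrow>\<^bsub>G\<^esub> y \<or> y \<rightarrow>\<^bsub>G\<^esub> u" using C(1) adj_mono by blast
  then show "\<exists>w. u \<rightarrow>\<^bsub>G\<^esub> w" using graph_symmetric by blast
next
  assume "\<exists>w. u \<rightarrow>\<^bsub>G\<^esub> w"
  then obtain w where w: "u \<rightarrow>\<^bsub>G\<^esub> w" by blast
  have u: "u \<in> verts G" using w adj_in_verts by blast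
  have ne: "u \<noteq> w" using w loopfree_digraph.adj_not_same[OF assms(2)] by blast
  have sub: "{u, w} \<subseteq> verts (G \<restriction> scc_of u)"
    using w in_scc_of_self[OF u] by (auto intro!: scc_ofI_reachable')
  have "scc_of u \<subseteq> verts G" by (auto simp: scc_of_def dest: reachable_in_verts)
  then have "finite (scc_of u)"
    using fin_digraph.finite_verts[OF assms(1)] finite_subset by blast
  then have "card {u, w} \<le> card (verts (G \<restriction> scc_of u))" using sub by (intro card_mono) auto
  then show "\<exists>C. component G C \<and> u \<in> verts C \<and> card (verts C) \<ge> 2"
    using component_scc_of[OF u] sub ne by (intro exI[of _ "G \<restriction> scc_of u"]) auto
qed

section \<open>Useful vertices as a measure of the game\<close>

context graph
begin

declare optimal_moves.simps [simp del]

definition useful :: "'a set \<Rightarrow> 'a set" where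
  "useful S = {u \<in> verts G - open_nbhd S. u \<in> S \<or> (\<exists>w \<in> verts G - open_nbhd S. u \<rightarrow>\<^bsub>G\<^esub> w)}"

lemma finite_useful [simp]: "finite (useful S)"
  by (rule finite_subset[of _ "verts G"]) (auto simp: useful_def)

lemma finite_playable [simp]: "finite (playable S)"
  by (rule finite_subset[of _ "verts G"]) (auto simp: playable_def)

lemma open_nbhd_iff: "v \<in> open_nbhd S \<longleftrightarrow> (\<exists>s \<in> S. v \<rightarrow>\<^bsub>G\<^esub> s)"
  using adj_in_verts by (auto simp: open_nbhd_def)

lemma playable_iff: "v \<in> playable S \<longleftrightarrow> (\<exists>u \<in> useful S. v \<rightarrow>\<^bsub>G\<^esub> u)"
proof -
  let ?U = "verts G - open_nbhd S"
  let ?H = "delete_verts (open_nbhd S)"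
  have H: "?H = G \<restriction> ?U" by (simp add: delete_verts_def)
  have ind: "induced_subgraph ?H G" unfolding H by (intro induced_induce) auto
  have "sym_digraph ?H"
    using ind unfolding H
    by (intro wf_digraph.sym_digraphI induced_graph_imp_symmetric[OF sym_arcs]) auto
  then interpret H: sym_digraph ?H .
  have dig: "digraph ?H" using digraphI_induced[OF ind] .
  have adj: "u \<rightarrow>\<^bsub>?H\<^esub> w \<longleftrightarrow> u \<in> ?U \<and> w \<in> ?U \<and> u \<rightarrow>\<^bsub>G\<^esub> w" for u w
    unfolding H by (auto simp: arcs_ends_conv)
  have verts_H: "verts ?H = ?U" by (simp add: H)
  \<comment> \<open>An undominated selected vertex either is isolated in \<open>?H\<close> or has an
    undominated neighbour, so both clauses together admit every such vertex.\<close>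
  have "u \<in> useful S \<longleftrightarrow> u \<in> verts G \<and>
     ((\<exists>C. component ?H C \<and> u \<in> verts C \<and> card (verts C) \<ge> 2) \<or> (u \<in> S \<and> isolated_vertex ?H u))" for u
    using H.in_nontrivial_component_iff[of u] dig
    by (auto simp: useful_def adj isolated_vertex_def digraph_def verts_H)
  then show ?thesis unfolding playable_def using adj_in_verts by blast
qed

text \<open>Only \<open>v\<close> could become useful by being selected, but it is adjacent to an
  undominated vertex, so if undominated it was useful before.\<close>

lemma useful_insert_subset:
  assumes "v \<in> playable S"
  shows "useful (insert v S) \<subseteq> useful S"
  using assms by (auto simp: playable_iff useful_def open_nbhd_iff)

lemma card_useful_insert:
  assumes "v \<in> playable S" "X \<subseteq> useful S" "X \<inter> useful (insert v S) = {}"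
  shows "card (useful (insert v S)) + card X \<le> card (useful S)"
proof -
  have "card (useful (insert v S)) + card X = card (useful (insert v S) \<union> X)"
    using assms finite_subset[OF assms(2)] by (subst card_Un_disjoint) auto
  also have "\<dots> \<le> card (useful S)"
    using assms useful_insert_subset by (intro card_mono) auto
  finally show ?thesis .
qed

lemma card_useful_insert_less:
  assumes "v \<in> playable S"
  shows "card (useful (insert v S)) + 1 \<le> card (useful S)"
proof -
  obtain u where "u \<in> useful S" "v \<rightarrow>\<^bsub>G\<^esub> u" using assms by (auto simp: playable_iff)
  then show ?thesis
    using card_useful_insert[OF assms, of "{u}"] graph_symmetric[of v u]
    by (auto simp: useful_def open_nbhd_iff)
qed

lemma optimal_moves_Dominator_le:
  assumes "v \<in> playable S"
  shows "optimal_moves Dominator S \<le> 1 + optimal_moves Staller (insert v S)"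
proof -
  have "Min ((\<lambda>v. optimal_moves Staller (insert v S)) ` playable S)
      \<le> optimal_moves Staller (insert v S)"
    using assms by (intro Min_le) auto
  moreover have "playable S \<noteq> {}" using assms by blast
  ultimately show ?thesis by (subst optimal_moves.simps) (simp only: if_False)
qed

lemma optimal_moves_Staller_cases:
  obtains (over) "optimal_moves Staller S = 0"
  | (move) v where "v \<in> playable S"
      "optimal_moves Staller S = 1 + optimal_moves Dominator (insert v S)"
proof (cases "playable S = {}")
  case True
  then show thesis using over by (simp add: optimal_moves.simps)
next
  case False
  then have "Max ((\<lambda>v. optimal_moves Dominator (insert v S)) ` playable S)
      \<in> (\<lambda>v. optimal_moves Dominator (insert v S)) ` playable S"
    by (intro Max_in) auto
  then obtain v where v: "v \<in> playable S"
      "Max ((\<lambda>v. optimal_moves Dominator (insert v S)) ` playable S)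
        = optimal_moves Dominator (insert v S)" by blast
  have "optimal_moves Staller S
      = 1 + Max ((\<lambda>v. optimal_moves Dominator (insert v S)) ` playable S)"
    using False by (subst optimal_moves.simps) (simp only: if_False)
  then show thesis using move v by simp
qed

lemma optimal_moves_le_card_useful: "optimal_moves p S \<le> card (useful S)"
proof (induction p S rule: optimal_moves.induct)
  case (1 S)
  show ?case
  proof (cases "playable S = {}")
    case False
    then obtain v where v: "v \<in> playable S" by blast
    show ?thesis
      using 1[OF False v] card_useful_insert_less[OF v] optimal_moves_Dominator_le[OF v]
      by linarith
  qed (simp add: optimal_moves.simps)
next
  case (2 S)
  show ?case
  proof (cases S rule: optimal_moves_Staller_cases)
    case (move v)
    then have "playable S \<noteq> {}" by blast
    then show ?thesis
      using 2[OF _ move(1)] card_useful_insert_less[OF move(1)] move(2) by linarith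
  qed simp
qed

end

section \<open>Positions with and without a double move\<close>

locale connected_graph = graph +
  assumes connected: "Digraph_Component.connected G"
    and card_verts: "card (verts G) \<ge> 3"
begin

lemma exits:
  assumes "X \<subseteq> verts G" "X \<noteq> {}" "card X < card (verts G)"
  obtains x y where "x \<in> X" "y \<notin> X" "x \<rightarrow>\<^bsub>G\<^esub> y"
  using connected_crossing_arc[OF wf_digraph connected assms(1,2)] assms(3) graph_symmetric
  by (metis Diff_iff less_irrefl)

lemma has_neighbour:
  assumes "v \<in> verts G"
  obtains w where "v \<rightarrow>\<^bsub>G\<^esub> w"
  using exits[of "{v}"] assms card_verts by auto

text \<open>An unselected useful vertex lies on an edge with both ends undominated. If such edges
  share an end, playing it dominates two useful vertices; otherwise they form a matching, and
  playing an outside neighbour of one edge makes both its ends useless.\<close>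

lemma double_move:
  assumes "\<not> useful S \<subseteq> S"
  obtains v where "v \<in> playable S" "card (useful (insert v S)) + 2 \<le> card (useful S)"
proof -
  obtain x y where x: "x \<in> verts G - open_nbhd S" and y: "y \<in> verts G - open_nbhd S" and xy: "x \<rightarrow>\<^bsub>G\<^esub> y"
    using assms by (auto simp: useful_def)
  have yx: "y \<rightarrow>\<^bsub>G\<^esub> x" using xy graph_symmetric by blast
  have ne: "x \<noteq> y" using xy adj_not_same by blast
  show thesis
  proof (cases "\<exists>a b c. {a, b, c} \<subseteq> verts G - open_nbhd S \<and> b \<noteq> c \<and> a \<rightarrow>\<^bsub>G\<^esub> b \<and> a \<rightarrow>\<^bsub>G\<^esub> c")
    case True
    then obtain a b c where abc: "{a, b, c} \<subseteq> verts G - open_nbhd S" "b \<noteq> c" "a \<rightarrow>\<^bsub>G\<^esub> b" "a \<rightarrow>\<^bsub>G\<^esub> c"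
      by blast
    have sym: "b \<rightarrow>\<^bsub>G\<^esub> a" "c \<rightarrow>\<^bsub>G\<^esub> a" using abc graph_symmetric by blast+
    have U: "{b, c} \<subseteq> useful S" using abc sym by (auto simp: useful_def)
    then have "a \<in> playable S" using abc by (auto simp: playable_iff)
    moreover have "{b, c} \<inter> useful (insert a S) = {}"
      using sym by (auto simp: useful_def open_nbhd_iff)
    ultimately show thesis
      using that[of a] card_useful_insert[of a S "{b, c}"] U abc(2) by auto
  next
    case False
    have "card {x, y} < card (verts G)" using card_verts ne by auto
    then obtain p z where "p \<in> {x, y}" and "z \<notin> {x, y}" "p \<rightarrow>\<^bsub>G\<^esub> z"
      using exits[of "{x, y}"] x y by auto
    moreover define q where "q = (if p = x then y else x)"
    ultimately have pq: "{p, q} = {x, y}" and z: "z \<notin> {p, q}" "p \<rightarrow>\<^bsub>G\<^esub> z"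
      by auto
    have U: "{p, q} \<subseteq> useful S" "card {p, q} = 2"
      unfolding pq using x y xy yx ne by (auto simp: useful_def)
    have qp: "q \<rightarrow>\<^bsub>G\<^esub> p" "p \<rightarrow>\<^bsub>G\<^esub> q" using pq xy yx ne by (auto simp: doubleton_eq_iff)
    have "z \<rightarrow>\<^bsub>G\<^esub> p" using z(2) graph_symmetric by blast
    then have play: "z \<in> playable S" using U by (auto simp: playable_iff)
    \<comment> \<open>\<open>q\<close> is not selected, as its neighbour \<open>p\<close> is
      undominated. Hence \<open>q\<close> is useful only through \<open>p\<close>, its sole
      undominated neighbour, which \<open>z\<close> dominates.\<close>
    have "q \<notin> S" using U(1) qp by (auto simp: useful_def open_nbhd_iff)
    have "w = p" if "q \<rightarrow>\<^bsub>G\<^esub> w" "w \<in> verts G - open_nbhd S" for w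
      using False that qp U(1) by (auto simp: useful_def)
    then have "q \<notin> useful (insert z S)"
      using \<open>q \<notin> S\<close> z by (auto simp: useful_def open_nbhd_iff)
    moreover have "p \<notin> useful (insert z S)" using z by (auto simp: useful_def open_nbhd_iff)
    ultimately show thesis
      using that[of z] card_useful_insert[OF play U(1)] U(2) play by auto
  qed
qed

text \<open>Three disjoint sets are counted: the useful vertices, all selected; one unselected
  neighbour \<open>f u\<close> of each; and the selected dominated vertices.\<close>

lemma card_useful_no_double_move:
  assumes "\<And>v. v \<in> playable S \<Longrightarrow> card (useful S) < card (useful (insert v S)) + 2"
  shows "2 * card (useful S) + card (S \<inter> open_nbhd S) \<le> card (verts G)"
proof -
  have sub: "useful S \<subseteq> S"
  proof (rule ccontr)
    assume "\<not> useful S \<subseteq> S"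
    then obtain v where "v \<in> playable S" "card (useful (insert v S)) + 2 \<le> card (useful S)"
      by (rule double_move)
    then show False using assms[of v] by linarith
  qed
  have "\<exists>w. u \<rightarrow>\<^bsub>G\<^esub> w" if "u \<in> useful S" for u
    using that has_neighbour[of u] by (auto simp: useful_def)
  then obtain f where f: "\<And>u. u \<in> useful S \<Longrightarrow> u \<rightarrow>\<^bsub>G\<^esub> f u" by metis
  \<comment> \<open>A common value of \<open>f\<close> would be a move dominating two useful
    vertices.\<close>
  have "inj_on f (useful S)"
  proof
    fix a b assume ab: "a \<in> useful S" "b \<in> useful S" "f a = f b"
    have fa: "a \<rightarrow>\<^bsub>G\<^esub> f a" "b \<rightarrow>\<^bsub>G\<^esub> f a" using f ab by metis+
    show "a = b"
    proof (rule ccontr)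
      assume "a \<noteq> b"
      have play: "f a \<in> playable S" using fa ab graph_symmetric by (auto simp: playable_iff)
      moreover have "{a, b} \<inter> useful (insert (f a) S) = {}"
        using fa by (auto simp: useful_def open_nbhd_iff)
      ultimately show False
        using card_useful_insert[of "f a" S "{a, b}"] assms[OF play] ab \<open>a \<noteq> b\<close> by auto
    qed
  qed
  then have cf: "card (f ` useful S) = card (useful S)" by (rule card_image)
  have fS: "f ` useful S \<inter> S = {}" using f by (auto simp: useful_def open_nbhd_iff)
  have fin: "finite (S \<inter> open_nbhd S)"
    by (rule finite_subset[of _ "verts G"]) (auto simp: open_nbhd_def)
  have "card (f ` useful S \<union> (useful S \<union> (S \<inter> open_nbhd S)))
      = card (useful S) + (card (useful S) + card (S \<inter> open_nbhd S))"
    using fS sub fin cf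
    by (subst card_Un_disjoint, simp, simp, blast, subst card_Un_disjoint)
      (auto simp: useful_def)
  moreover have "f ` useful S \<union> (useful S \<union> (S \<inter> open_nbhd S)) \<subseteq> verts G"
    using adj_in_verts(2)[OF f] by (auto simp: useful_def open_nbhd_def)
  then have "card (f ` useful S \<union> (useful S \<union> (S \<inter> open_nbhd S))) \<le> card (verts G)"
    by (rule card_mono[OF finite_verts])
  ultimately show ?thesis by linarith
qed

section \<open>Bounds on the number of moves\<close>

text \<open>A double move and Staller's answer cost at least three useful vertices, and 6 * 2 = 4 *
  3. Without a double move, \<open>k\<close> useful vertices satisfy 6k + c = 4k + (2k + c) \<le> 4k
  + n. The fixed \<open>c\<close> survives the induction because selected dominated vertices stay
  so.\<close>

lemma optimal_moves_Dominator_bound: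
  assumes "c \<le> card (S \<inter> open_nbhd S)"
  shows "6 * optimal_moves Dominator S + c \<le> 4 * card (useful S) + card (verts G)"
  using assms
proof (induction "card (useful S)" arbitrary: S rule: less_induct)
  case less
  \<comment> \<open>Serves the case where the game ends right after the double move: 6 + c \<le> 4 *
    2 + n.\<close>
  have c_le: "c \<le> card (verts G)"
    using less.prems by (rule order_trans) (intro card_mono, auto simp: open_nbhd_def)
  show ?case
  proof (cases "\<exists>v \<in> playable S. card (useful (insert v S)) + 2 \<le> card (useful S)")
    case True
    then obtain v where v: "v \<in> playable S" "card (useful (insert v S)) + 2 \<le> card (useful S)" by blast
    let ?S = "insert v S"
    have D: "optimal_moves Dominator S \<le> 1 + optimal_moves Staller ?S"
      using v(1) by (rule optimal_moves_Dominator_le)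
    show ?thesis
    proof (cases ?S rule: optimal_moves_Staller_cases)
      case over
      then show ?thesis using D v(2) c_le by linarith
    next
      case (move w)
      let ?T = "insert w ?S"
      have lt: "card (useful ?T) + 3 \<le> card (useful S)"
        using card_useful_insert_less[OF move(1)] v(2) by linarith
      have "card (S \<inter> open_nbhd S) \<le> card (?T \<inter> open_nbhd ?T)"
        by (rule card_mono, rule finite_subset[of _ "verts G"]) (auto simp: open_nbhd_def)
      then have "6 * optimal_moves Dominator ?T + c \<le> 4 * card (useful ?T) + card (verts G)"
        using less lt by auto
      then show ?thesis using D move(2) lt by linarith
    qed
  next
    case False
    then have "2 * card (useful S) + card (S \<inter> open_nbhd S) \<le> card (verts G)"
      by (intro card_useful_no_double_move) auto
    then show ?thesis using optimal_moves_le_card_useful[of Dominator S] less.prems by linarith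
  qed
qed

lemma reply_to_leaf:
  assumes leaf: "\<And>u. v \<rightarrow>\<^bsub>G\<^esub> u \<longleftrightarrow> u = w"
  shows "6 * optimal_moves Dominator {v} + 6 \<le> 5 * card (verts G)"
proof -
  have vw: "v \<rightarrow>\<^bsub>G\<^esub> w" "w \<rightarrow>\<^bsub>G\<^esub> v" using leaf graph_symmetric by blast+
  have ne: "v \<noteq> w" using vw adj_not_same by blast
  have "v \<in> verts G" "w \<in> verts G" using vw adj_in_verts by blast+
  then obtain p x where "p \<in> {v, w}" "x \<notin> {v, w}" "p \<rightarrow>\<^bsub>G\<^esub> x"
    using exits[of "{v, w}"] card_verts ne by auto
  \<comment> \<open>The edge leaving \<open>{v, w}\<close> starts at \<open>w\<close>, since
    \<open>v\<close> is a leaf; so the reply \<open>w\<close> dominates \<open>x\<close> besides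
    \<open>v\<close>, while \<open>v\<close> dominates \<open>w\<close>.\<close>
  then have x: "w \<rightarrow>\<^bsub>G\<^esub> x" "x \<noteq> v" "x \<noteq> w" using leaf by auto
  have "v \<in> useful {v}"
    using \<open>v \<in> verts G\<close> adj_not_same by (auto simp: useful_def open_nbhd_iff)
  then have "w \<in> playable {v}" using vw by (auto simp: playable_iff)
  let ?S = "{w, v}"
  have D: "optimal_moves Dominator {v} \<le> 1 + optimal_moves Staller ?S"
    using \<open>w \<in> playable {v}\<close> by (rule optimal_moves_Dominator_le)
  have "useful ?S \<subseteq> verts G - {v, w, x}"
    using vw x graph_symmetric[of w x] by (auto simp: useful_def open_nbhd_iff)
  then have "card (useful ?S) \<le> card (verts G - {v, w, x})" by (intro card_mono) auto
  also have "\<dots> = card (verts G) - 3"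
    using vw x ne adj_in_verts by (subst card_Diff_subset) auto
  finally have U: "card (useful ?S) + 3 \<le> card (verts G)" using card_verts by linarith
  show ?thesis
  proof (cases ?S rule: optimal_moves_Staller_cases)
    case over
    then show ?thesis using D card_verts by linarith
  next
    case (move y)
    let ?T = "insert y ?S"
    have "card {v, w} \<le> card (?T \<inter> open_nbhd ?T)"
      by (rule card_mono, rule finite_subset[of _ "verts G"])
        (use vw in \<open>auto simp: open_nbhd_iff dest: adj_in_verts\<close>)
    then have "2 \<le> card (?T \<inter> open_nbhd ?T)" using ne by auto
    then have "6 * optimal_moves Dominator ?T + 2 \<le> 4 * card (useful ?T) + card (verts G)"
      by (rule optimal_moves_Dominator_bound)
    \<comment> \<open>At most n - 4 useful vertices remain after \<open>y\<close>. With the two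
      moves \<open>w\<close>, \<open>y\<close> and c = 2 the bound is tight: 6 + 12 + 4(n - 4) + n -
      2 = 5n.\<close>
    then show ?thesis using card_useful_insert_less[OF move(1)] U D move(2) by linarith
  qed
qed

lemma staller_start_bound: "6 * optimal_moves Staller {} \<le> 5 * card (verts G)"
proof (cases "{} :: 'a set" rule: optimal_moves_Staller_cases)
  case over
  then show ?thesis by simp
next
  case (move v)
  have "v \<in> verts G" using move(1) by (auto simp: playable_def)
  then obtain w where w: "v \<rightarrow>\<^bsub>G\<^esub> w" by (rule has_neighbour)
  \<comment> \<open>The summand 6 pays for Staller's first move.\<close>
  have "6 * optimal_moves Dominator {v} + 6 \<le> 5 * card (verts G)"
  proof (cases "\<exists>u. v \<rightarrow>\<^bsub>G\<^esub> u \<and> u \<noteq> w")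
    case True
    then obtain u where u: "v \<rightarrow>\<^bsub>G\<^esub> u" "u \<noteq> w" by blast
    have "useful {v} \<subseteq> verts G - {u, w}"
      using u w graph_symmetric by (auto simp: useful_def open_nbhd_iff)
    then have "card (useful {v}) \<le> card (verts G - {u, w})" by (intro card_mono) auto
    also have "\<dots> = card (verts G) - 2"
      using u w adj_in_verts by (subst card_Diff_subset) auto
    finally have "card (useful {v}) + 2 \<le> card (verts G)" using card_verts by linarith
    \<comment> \<open>Two neighbours are dominated, so c = 0 suffices: 4(n - 2) + n + 6 \<le>
      5n.\<close>
    then show ?thesis using optimal_moves_Dominator_bound[of 0 "{v}"] by linarith
  next
    case False
    then show ?thesis using w by (intro reply_to_leaf) auto
  qed
  then show ?thesis using move(2) by linarith
qed

end

theorem theorem4p2: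
  fixes G :: "('a, 'b) pre_digraph"
  assumes "graph G"
    and "Digraph_Component.connected G"
    and "card (verts G) \<ge> 3"
  shows "real (graph.staller_start_game_number G) \<le> 5 / 6 * real (card (verts G))"
proof -
  interpret connected_graph G
    using assms by (intro connected_graph.intro connected_graph_axioms.intro)
  show ?thesis
    using staller_start_bound unfolding staller_start_game_number_def by linarith
qed

end
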